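(* Let $\mathcal{C},\mathcal{C}',\mathcal{D},\mathcal{D}'$ be small connected categories, let $\alpha\colon\mathcal{C}\to\mathcal{C}'$ and $\beta\colon\mathcal{D}\to\mathcal{D}'$ be homotopy equivalences, and let $F,G\colon\mathcal{C}\to\mathcal{D}$ and $F',G'\colon\mathcal{C}'\to\mathcal{D}'$ be functors such that $\beta\circ F=F'\circ\alpha$ and $\beta\circ G=G'\circ\alpha$. Then $$\mathrm{cD}(F,G)=\mathrm{cD}(F',G').$$
   Context: Interval category: for $m\ge 0$, $\mathcal{I}_m$ has objects $0,1,\dots,m$ and its only non-identity arrows are: exactly one arrow $r\to s$ whenever $r$ is even and $s=r-1$ or $s=r+1$. Two functors $F,G\colon\mathcal{C}\to\mathcal{D}$ between small categories are homotopic, $F\simeq G$, if for some $m\ge 0$ there is a functor $H\colon\mathcal{C}\times\mathcal{I}_m\to\mathcal{D}$ with $H_0=F$ and $H_m=G$ (equivalently, $F$ and $G$ are joined by a finite zigzag of natural transformations). A functor $F\colon\mathcal{C}\to\mathcal{D}$ is a homotopy equivalence if there is a functor $G\colon\mathcal{D}\to\mathcal{C}$ with $G\circ F\simeq 1_{\mathcal{C}}$ and $F\circ G\simeq 1_{\mathcal{D}}$. A small category is connected if any two objects are joined by a finite zigzag of arrows. Members of covers (subcategories) are not required to be connected. Geometric cover: a collection $\{\mathcal{U}_\lambda\}_{\lambda\in\Lambda}$ of subcategories of $\mathcal{C}$ such that for every sequence of composable arrows $f_1,\dots,f_n$ in $\mathcal{C}$ there is $\lambda\in\Lambda$ such that every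 $f_i$ belongs to $\mathcal{U}_\lambda$. Categorical homotopic distance: for functors $F,G\colon\mathcal{C}\to\mathcal{D}$, $\mathrm{cD}(F,G)$ is the least integer $n\ge 0$ such that there is a geometric cover $\{\mathcal{U}_0,\dots,\mathcal{U}_n\}$ of $\mathcal{C}$ with $F_{|\mathcal{U}_j}\simeq G_{|\mathcal{U}_j}$ for all $j$; it is $\infty$ if there is no such cover. *)

theory Defs
  imports Main "HOL-Library.Extended_Nat"
begin

text \<open>
  Small categories are carried by a set of objects and a set of arrows. The structure maps are
  total HOL functions of which only the values on these carriers matter;
  \<open>Comp C g f\<close> is the composite of \<open>g\<close> after \<open>f\<close>, meaningful when \<open>Cod C f = Dom C g\<close>.
\<close>

record ('o, 'a) cat =
  Obj :: "'o set"
  Arr :: "'a set"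
  Dom :: "'a \<Rightarrow> 'o"
  Cod :: "'a \<Rightarrow> 'o"
  Ident :: "'o \<Rightarrow> 'a"
  Comp :: "'a \<Rightarrow> 'a \<Rightarrow> 'a"

locale category =
  fixes C :: "('o, 'a) cat"
  assumes Dom_in: "f \<in> Arr C \<Longrightarrow> Dom C f \<in> Obj C"
    and Cod_in: "f \<in> Arr C \<Longrightarrow> Cod C f \<in> Obj C"
    and Ident_in: "x \<in> Obj C \<Longrightarrow> Ident C x \<in> Arr C"
    and Dom_Ident: "x \<in> Obj C \<Longrightarrow> Dom C (Ident C x) = x"
    and Cod_Ident: "x \<in> Obj C \<Longrightarrow> Cod C (Ident C x) = x"
    and Comp_in: "\<lbrakk>f \<in> Arr C; g \<in> Arr C; Cod C f = Dom C g\<rbrakk> \<Longrightarrow> Comp C g f \<in> Arr C"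
    and Dom_Comp: "\<lbrakk>f \<in> Arr C; g \<in> Arr C; Cod C f = Dom C g\<rbrakk> \<Longrightarrow> Dom C (Comp C g f) = Dom C f"
    and Cod_Comp: "\<lbrakk>f \<in> Arr C; g \<in> Arr C; Cod C f = Dom C g\<rbrakk> \<Longrightarrow> Cod C (Comp C g f) = Cod C g"
    and Comp_Ident_right: "f \<in> Arr C \<Longrightarrow> Comp C f (Ident C (Dom C f)) = f"
    and Comp_Ident_left: "f \<in> Arr C \<Longrightarrow> Comp C (Ident C (Cod C f)) f = f"
    and Comp_assoc: "\<lbrakk>f \<in> Arr C; g \<in> Arr C; h \<in> Arr C; Cod C f = Dom C g; Cod C g = Dom C h\<rbrakk>
      \<Longrightarrow> Comp C h (Comp C g f) = Comp C (Comp C h g) f"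

definition connected_category :: "('o, 'a) cat \<Rightarrow> bool" where
  "connected_category C \<longleftrightarrow> (\<forall>x\<in>Obj C. \<forall>y\<in>Obj C.
     (x, y) \<in> ({(Dom C f, Cod C f) |f. f \<in> Arr C} \<union> {(Cod C f, Dom C f) |f. f \<in> Arr C})\<^sup>*)"

locale subcategory = category C + category U
  for U :: "('o, 'a) cat" and C :: "('o, 'a) cat" +
  assumes Obj_sub: "Obj U \<subseteq> Obj C"
    and Arr_sub: "Arr U \<subseteq> Arr C"
    and Dom_sub: "f \<in> Arr U \<Longrightarrow> Dom U f = Dom C f"
    and Cod_sub: "f \<in> Arr U \<Longrightarrow> Cod U f = Cod C f"
    and Ident_sub: "x \<in> Obj U \<Longrightarrow> Ident U x = Ident C x"
    and Comp_sub: "\<lbrakk>f \<in> Arr U; g \<in> Arr U; Cod U f = Dom U g\<rbrakk> \<Longrightarrow> Comp U g f = Comp C g f"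

record ('o, 'a, 'p, 'b) fctr =
  on_obj :: "'o \<Rightarrow> 'p"
  on_arr :: "'a \<Rightarrow> 'b"

locale is_functor = category C + category D
  for C :: "('o, 'a) cat" and D :: "('p, 'b) cat" and F :: "('o, 'a, 'p, 'b) fctr" +
  assumes on_obj_in: "x \<in> Obj C \<Longrightarrow> on_obj F x \<in> Obj D"
    and on_arr_in: "f \<in> Arr C \<Longrightarrow> on_arr F f \<in> Arr D"
    and on_arr_Dom: "f \<in> Arr C \<Longrightarrow> Dom D (on_arr F f) = on_obj F (Dom C f)"
    and on_arr_Cod: "f \<in> Arr C \<Longrightarrow> Cod D (on_arr F f) = on_obj F (Cod C f)"
    and on_arr_Ident: "x \<in> Obj C \<Longrightarrow> on_arr F (Ident C x) = Ident D (on_obj F x)"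
    and on_arr_Comp: "\<lbrakk>f \<in> Arr C; g \<in> Arr C; Cod C f = Dom C g\<rbrakk>
      \<Longrightarrow> on_arr F (Comp C g f) = Comp D (on_arr F g) (on_arr F f)"

text \<open>
  Equality of functors with source \<open>C\<close>: agreement on the carriers. Since a functor is given by
  total maps, the restriction of a functor to a subcategory \<open>U\<close> is the same pair of maps regarded
  as a functor with source \<open>U\<close>.
\<close>

definition functor_eq ::
    "('o, 'a) cat \<Rightarrow> ('o, 'a, 'p, 'b) fctr \<Rightarrow> ('o, 'a, 'p, 'b) fctr \<Rightarrow> bool" where
  "functor_eq C F G \<longleftrightarrow>
     (\<forall>x\<in>Obj C. on_obj F x = on_obj G x) \<and> (\<forall>f\<in>Arr C. on_arr F f = on_arr G f)"

definition id_functor :: "('o, 'a, 'o, 'a) fctr" where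
  "id_functor = \<lparr>on_obj = (\<lambda>x. x), on_arr = (\<lambda>f. f)\<rparr>"

definition comp_functor ::
    "('p, 'b, 'q, 'c) fctr \<Rightarrow> ('o, 'a, 'p, 'b) fctr \<Rightarrow> ('o, 'a, 'q, 'c) fctr" where
  "comp_functor G F =
     \<lparr>on_obj = (\<lambda>x. on_obj G (on_obj F x)), on_arr = (\<lambda>f. on_arr G (on_arr F f))\<rparr>"

definition prod_cat :: "('o, 'a) cat \<Rightarrow> ('p, 'b) cat \<Rightarrow> ('o \<times> 'p, 'a \<times> 'b) cat" where
  "prod_cat C D =
     \<lparr>Obj = Obj C \<times> Obj D,
      Arr = Arr C \<times> Arr D,
      Dom = (\<lambda>(f, g). (Dom C f, Dom D g)),
      Cod = (\<lambda>(f, g). (Cod C f, Cod D g)),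
      Ident = (\<lambda>(x, y). (Ident C x, Ident D y)),
      Comp = (\<lambda>(f', g') (f, g). (Comp C f' f, Comp D g' g))\<rparr>"

text \<open>
  The unique arrow from \<open>r\<close> to \<open>s\<close> of an interval category is encoded as the pair \<open>(r, s)\<close>.
  The condition \<open>r = s + 1\<close> says \<open>s = r - 1\<close> without truncated subtraction.
\<close>

definition interval_cat :: "nat \<Rightarrow> (nat, nat \<times> nat) cat" where
  "interval_cat m =
     \<lparr>Obj = {..m},
      Arr = {(r, s). r \<le> m \<and> s \<le> m \<and> (r = s \<or> even r \<and> (r = s + 1 \<or> s = r + 1))},
      Dom = fst,
      Cod = snd,
      Ident = (\<lambda>r. (r, r)),
      Comp = (\<lambda>g f. (fst f, snd g))\<rparr>"

lemma category_interval_cat: "category (interval_cat m)"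
  by unfold_locales (auto simp: interval_cat_def)

lemma category_prod_cat:
  assumes "category C" and "category D"
  shows "category (prod_cat C D)"
proof -
  interpret C: category C by fact
  interpret D: category D by fact
  show ?thesis
    by unfold_locales
      (auto simp: prod_cat_def C.Dom_in C.Cod_in C.Ident_in C.Dom_Ident C.Cod_Ident C.Comp_in
        C.Dom_Comp C.Cod_Comp C.Comp_Ident_right C.Comp_Ident_left C.Comp_assoc
        D.Dom_in D.Cod_in D.Ident_in D.Dom_Ident D.Cod_Ident D.Comp_in
        D.Dom_Comp D.Cod_Comp D.Comp_Ident_right D.Comp_Ident_left D.Comp_assoc)
qed

text \<open>The functor \<open>H\<^sub>r\<close> obtained from \<open>H\<close> by fixing the object \<open>r\<close> of the interval.\<close>

definition slice_at ::
    "nat \<Rightarrow> nat \<Rightarrow> ('o \<times> nat, 'a \<times> (nat \<times> nat), 'p, 'b) fctr \<Rightarrow> ('o, 'a, 'p, 'b) fctr" where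
  "slice_at m r H =
     \<lparr>on_obj = (\<lambda>x. on_obj H (x, r)),
      on_arr = (\<lambda>f. on_arr H (f, Ident (interval_cat m) r))\<rparr>"

definition homotopic :: "('o, 'a) cat \<Rightarrow> ('p, 'b) cat \<Rightarrow>
    ('o, 'a, 'p, 'b) fctr \<Rightarrow> ('o, 'a, 'p, 'b) fctr \<Rightarrow> bool" where
  "homotopic C D F G \<longleftrightarrow>
     (\<exists>m H. is_functor (prod_cat C (interval_cat m)) D H \<and>
            functor_eq C (slice_at m 0 H) F \<and> functor_eq C (slice_at m m H) G)"

definition homotopy_equivalence ::
    "('o, 'a) cat \<Rightarrow> ('p, 'b) cat \<Rightarrow> ('o, 'a, 'p, 'b) fctr \<Rightarrow> bool" where
  "homotopy_equivalence C D F \<longleftrightarrow> is_functor C D F \<and>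
     (\<exists>G. is_functor D C G \<and>
          homotopic C C (comp_functor G F) id_functor \<and>
          homotopic D D (comp_functor F G) id_functor)"

definition composable_arrows :: "('o, 'a) cat \<Rightarrow> 'a list \<Rightarrow> bool" where
  "composable_arrows C fs \<longleftrightarrow> fs \<noteq> [] \<and> set fs \<subseteq> Arr C \<and>
     (\<forall>i. Suc i < length fs \<longrightarrow> Cod C (fs ! i) = Dom C (fs ! Suc i))"

definition geometric_cover :: "('o, 'a) cat \<Rightarrow> 'l set \<Rightarrow> ('l \<Rightarrow> ('o, 'a) cat) \<Rightarrow> bool" where
  "geometric_cover C L U \<longleftrightarrow>
     (\<forall>l\<in>L. subcategory (U l) C) \<and>
     (\<forall>fs. composable_arrows C fs \<longrightarrow> (\<exists>l\<in>L. set fs \<subseteq> Arr (U l)))"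

definition homotopic_cover_of_size :: "('o, 'a) cat \<Rightarrow> ('p, 'b) cat \<Rightarrow>
    ('o, 'a, 'p, 'b) fctr \<Rightarrow> ('o, 'a, 'p, 'b) fctr \<Rightarrow> nat \<Rightarrow> bool" where
  "homotopic_cover_of_size C D F G n \<longleftrightarrow>
     (\<exists>U :: nat \<Rightarrow> ('o, 'a) cat.
        geometric_cover C {..n} U \<and> (\<forall>j\<le>n. homotopic (U j) D F G))"

definition cD :: "('o, 'a) cat \<Rightarrow> ('p, 'b) cat \<Rightarrow>
    ('o, 'a, 'p, 'b) fctr \<Rightarrow> ('o, 'a, 'p, 'b) fctr \<Rightarrow> enat" where
  "cD C D F G =
     (if \<exists>n. homotopic_cover_of_size C D F G n
      then enat (LEAST n. homotopic_cover_of_size C D F G n)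
      else \<infinity>)"

end

theory Submission
  imports Defs
begin

text \<open>
  Covers with homotopic restrictions can be pulled back. Let \<open>p: E \<rightarrow> C\<close> and
  \<open>q: D \<rightarrow> B\<close> be functors with \<open>K \<simeq> q F p\<close> and \<open>L \<simeq> q G p\<close>. The preimages under \<open>p\<close> of the
  members of a geometric cover of \<open>C\<close> form a geometric cover of \<open>E\<close>, because \<open>p\<close> maps composable
  sequences to composable sequences; and if \<open>F \<simeq> G\<close> on \<open>U\<close>, then
  \<open>K \<simeq> q F p \<simeq> q G p \<simeq> L\<close> on \<open>p\<^sup>-\<^sup>1 U\<close>. This is \<open>homotopic_cover_of_size_transfer\<close>.

  Homotopy inverses \<open>\<alpha>'\<close> and \<open>\<beta>'\<close> of \<open>\<alpha>\<close> and \<open>\<beta>\<close> make it applicable in both directions. On the one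
  hand \<open>F' \<simeq> F' \<alpha> \<alpha>' = \<beta> F \<alpha>'\<close>, so covers of \<open>C\<close> pull back along \<open>p = \<alpha>'\<close> with \<open>q = \<beta>\<close>; on the
  other hand \<open>F \<simeq> \<beta>' \<beta> F = \<beta>' F' \<alpha>\<close>, so covers of \<open>C'\<close> pull back along \<open>p = \<alpha>\<close> with \<open>q = \<beta>'\<close>;
  likewise for \<open>G\<close> and \<open>G'\<close>. Hence the same numbers occur as sizes of covers on both sides.

  What this rests on is that homotopy is an equivalence relation stable under composition on either
  side. Since the arrows of \<open>interval_cat m\<close> leave the even objects, reversing an interval, or
  appending another one to it, respects the arrows when \<open>m\<close> is even; a homotopy of odd
  length is first prolonged by a constant step.
\<close>

section \<open>Composites, products and projections of functors\<close>

lemma is_functor_comp: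
  assumes "is_functor C D F" and "is_functor D E G"
  shows "is_functor C E (comp_functor G F)"
proof -
  interpret F: is_functor C D F by fact
  interpret G: is_functor D E G by fact
  show ?thesis
    by unfold_locales
      (simp_all add: comp_functor_def F.on_obj_in F.on_arr_in F.on_arr_Dom F.on_arr_Cod
        F.on_arr_Ident F.on_arr_Comp G.on_obj_in G.on_arr_in G.on_arr_Dom G.on_arr_Cod
        G.on_arr_Ident G.on_arr_Comp)
qed

lemma is_functor_categories:
  assumes "is_functor C D F"
  shows category_source: "category C" and category_target: "category D"
  using assms by (simp_all add: is_functor_def)

lemma category_subcategory: "subcategory U C \<Longrightarrow> category U"
  by (simp add: subcategory_def)

lemma is_functor_inclusion:
  assumes "subcategory U C"
  shows "is_functor U C id_functor"
proof -
  interpret subcategory U C by fact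
  show ?thesis
    using Obj_sub Arr_sub
    by unfold_locales (auto simp: id_functor_def Dom_sub Cod_sub Ident_sub Comp_sub)
qed

lemma subcategory_refl: "category C \<Longrightarrow> subcategory C C"
  by (simp add: subcategory_def subcategory_axioms_def)

definition prod_functor ::
    "('o, 'a, 'p, 'b) fctr \<Rightarrow> ('q, 'c, 'r, 'd) fctr \<Rightarrow> ('o \<times> 'q, 'a \<times> 'c, 'p \<times> 'r, 'b \<times> 'd) fctr" where
  "prod_functor F G = \<lparr>on_obj = map_prod (on_obj F) (on_obj G), on_arr = map_prod (on_arr F) (on_arr G)\<rparr>"

lemma is_functor_prod:
  assumes "is_functor C D F" and "is_functor C' D' F'"
  shows "is_functor (prod_cat C C') (prod_cat D D') (prod_functor F F')"
proof -
  interpret F: is_functor C D F by fact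
  interpret F': is_functor C' D' F' by fact
  interpret CC': category "prod_cat C C'"
    using assms by (intro category_prod_cat) (auto dest: category_source)
  interpret DD': category "prod_cat D D'"
    using assms by (intro category_prod_cat) (auto dest: category_target)
  show ?thesis
    by unfold_locales
      (auto simp: prod_functor_def prod_cat_def F.on_obj_in F.on_arr_in F.on_arr_Dom F.on_arr_Cod
        F.on_arr_Ident F.on_arr_Comp F'.on_obj_in F'.on_arr_in F'.on_arr_Dom F'.on_arr_Cod
        F'.on_arr_Ident F'.on_arr_Comp)
qed

definition fst_functor :: "('o \<times> 'p, 'a \<times> 'b, 'o, 'a) fctr" where
  "fst_functor = \<lparr>on_obj = fst, on_arr = fst\<rparr>"

lemma is_functor_fst:
  assumes "category C" and "category D"
  shows "is_functor (prod_cat C D) C fst_functor"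
proof -
  interpret C: category C by fact
  interpret CD: category "prod_cat C D" using assms by (rule category_prod_cat)
  show ?thesis
    by unfold_locales (auto simp: fst_functor_def prod_cat_def)
qed

section \<open>Homotopy as an equivalence relation\<close>

definition interval_functor :: "(nat \<Rightarrow> nat) \<Rightarrow> (nat, nat \<times> nat, nat, nat \<times> nat) fctr" where
  "interval_functor \<phi> = \<lparr>on_obj = \<phi>, on_arr = map_prod \<phi> \<phi>\<rparr>"

lemma is_functor_interval:
  assumes "\<And>r s. (r, s) \<in> Arr (interval_cat n) \<Longrightarrow> (\<phi> r, \<phi> s) \<in> Arr (interval_cat m)"
  shows "is_functor (interval_cat n) (interval_cat m) (interval_functor \<phi>)"
proof -
  interpret M: category "interval_cat m" by (rule category_interval_cat)
  interpret N: category "interval_cat n" by (rule category_interval_cat)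
  have "on_obj (interval_functor \<phi>) r \<in> Obj (interval_cat m)" if "r \<in> Obj (interval_cat n)" for r
    using assms[of r r] that by (simp add: interval_functor_def interval_cat_def)
  moreover have "on_arr (interval_functor \<phi>) f \<in> Arr (interval_cat m)"
    if "f \<in> Arr (interval_cat n)" for f
    using assms[of "fst f" "snd f"] that by (simp add: interval_functor_def map_prod_def case_prod_beta)
  ultimately show ?thesis
    by unfold_locales (simp_all add: interval_functor_def interval_cat_def)
qed

definition homotopy_of_length :: "nat \<Rightarrow> ('o, 'a) cat \<Rightarrow> ('p, 'b) cat \<Rightarrow>
    ('o \<times> nat, 'a \<times> nat \<times> nat, 'p, 'b) fctr \<Rightarrow> ('o, 'a, 'p, 'b) fctr \<Rightarrow> ('o, 'a, 'p, 'b) fctr \<Rightarrow> bool" where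
  "homotopy_of_length m C D H F G \<longleftrightarrow> is_functor (prod_cat C (interval_cat m)) D H \<and>
     functor_eq C (slice_at m 0 H) F \<and> functor_eq C (slice_at m m H) G"

lemma homotopic_iff: "homotopic C D F G \<longleftrightarrow> (\<exists>m H. homotopy_of_length m C D H F G)"
  by (simp add: homotopic_def homotopy_of_length_def)

lemma is_functor_reparametrize:
  assumes "category C" and "is_functor (prod_cat C (interval_cat m)) D H"
    and "\<And>r s. (r, s) \<in> Arr (interval_cat n) \<Longrightarrow> (\<phi> r, \<phi> s) \<in> Arr (interval_cat m)"
  shows "is_functor (prod_cat C (interval_cat n)) D
    (comp_functor H (prod_functor id_functor (interval_functor \<phi>)))"
  by (intro is_functor_comp[OF is_functor_prod assms(2)] is_functor_interval assms(3)
      is_functor_inclusion subcategory_refl assms(1))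

lemma slice_at_reparametrize:
  "slice_at n r (comp_functor H (prod_functor id_functor (interval_functor \<phi>))) = slice_at m (\<phi> r) H"
  by (simp add: slice_at_def comp_functor_def prod_functor_def id_functor_def interval_functor_def
      interval_cat_def)

text \<open>
  The map \<open>min m\<close> collapses the last step of the interval of length \<open>Suc m\<close> to an identity,
  whichever way that step points, so a homotopy of odd length can be prolonged by a constant step.
\<close>

lemma even_homotopy:
  assumes "category C" and "homotopic C D F G"
  obtains m H where "even m" and "homotopy_of_length m C D H F G"
proof -
  obtain m H where H: "homotopy_of_length m C D H F G"
    using assms(2) by (auto simp: homotopic_iff)
  show thesis
  proof (cases "even m")
    case True
    then show thesis using H by (rule that)
  next
    case False
    let ?K = "comp_functor H (prod_functor id_functor (interval_functor (min m)))"
    have "(min m r, min m s) \<in> Arr (interval_cat m)" if "(r, s) \<in> Arr (interval_cat (Suc m))" for r s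
      using that False by (auto simp: interval_cat_def min_def le_Suc_eq)
    then have "is_functor (prod_cat C (interval_cat (Suc m))) D ?K"
      using H by (intro is_functor_reparametrize[where m = m] assms(1))
        (auto simp: homotopy_of_length_def)
    then have "homotopy_of_length (Suc m) C D ?K F G"
      using H unfolding homotopy_of_length_def slice_at_reparametrize[where m = m] by simp
    with False show thesis by (intro that[of "Suc m"]) simp_all
  qed
qed

lemma homotopic_functor_eq:
  assumes "is_functor C D F" and "functor_eq C F G"
  shows "homotopic C D F G"
proof -
  have "is_functor (prod_cat C (interval_cat 0)) D (comp_functor F fst_functor)"
    using is_functor_fst[OF category_source[OF assms(1)] category_interval_cat] assms(1)
    by (rule is_functor_comp)
  moreover have "slice_at 0 0 (comp_functor F fst_functor) = F"
    by (simp add: slice_at_def comp_functor_def fst_functor_def)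
  moreover have "functor_eq C F F"
    by (simp add: functor_eq_def)
  ultimately show ?thesis
    using assms(2) unfolding homotopic_def by metis
qed

lemma homotopic_sym:
  assumes "category C" and "homotopic C D F G"
  shows "homotopic C D G F"
proof -
  obtain m H where m: "even m" and H: "homotopy_of_length m C D H F G"
    using assms by (rule even_homotopy)
  let ?K = "comp_functor H (prod_functor id_functor (interval_functor (\<lambda>r. m - r)))"
  have "is_functor (prod_cat C (interval_cat m)) D ?K"
    using m H by (intro is_functor_reparametrize[where m = m] assms(1))
      (auto simp: homotopy_of_length_def interval_cat_def)
  then have "homotopy_of_length m C D ?K G F"
    using H unfolding homotopy_of_length_def slice_at_reparametrize[where m = m] by simp
  then show ?thesis by (auto simp: homotopic_iff)
qed

definition concat_homotopy :: "nat \<Rightarrow> ('o \<times> nat, 'a \<times> nat \<times> nat, 'p, 'b) fctr \<Rightarrow>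
    ('o \<times> nat, 'a \<times> nat \<times> nat, 'p, 'b) fctr \<Rightarrow> ('o \<times> nat, 'a \<times> nat \<times> nat, 'p, 'b) fctr" where
  "concat_homotopy m H K =
     \<lparr>on_obj = (\<lambda>(x, r). if r \<le> m then on_obj H (x, r) else on_obj K (x, r - m)),
      on_arr = (\<lambda>(f, r, s). if r \<le> m \<and> s \<le> m then on_arr H (f, r, s)
                             else on_arr K (f, r - m, s - m))\<rparr>"

text \<open>
  Every arrow of the long interval lies in one of its two halves, and so does every composable pair.
  The halves share only the object \<open>m\<close>, where both homotopies restrict to \<open>G\<close>.
\<close>

lemma homotopy_of_length_concat:
  assumes "category C" and "even m"
    and H: "homotopy_of_length m C D H F G" and K: "homotopy_of_length n C D K G L"
  shows "homotopy_of_length (m + n) C D (concat_homotopy m H K) F L"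
proof -
  let ?I = "\<lambda>k. prod_cat C (interval_cat k)"
  let ?HK = "concat_homotopy m H K"
  interpret C: category C by fact
  interpret H: is_functor "?I m" D H using H by (simp add: homotopy_of_length_def)
  interpret K: is_functor "?I n" D K using K by (simp add: homotopy_of_length_def)
  interpret HK: category "?I (m + n)"
    using assms(1) category_interval_cat by (rule category_prod_cat)
  have glue_obj: "on_obj H (x, m) = on_obj K (x, 0)" if "x \<in> Obj C" for x
    using H K that by (simp add: homotopy_of_length_def functor_eq_def slice_at_def)
  have glue_arr: "on_arr H (f, m, m) = on_arr K (f, 0, 0)" if "f \<in> Arr C" for f
    using H K that by (simp add: homotopy_of_length_def functor_eq_def slice_at_def interval_cat_def)
  have lower_obj: "on_obj ?HK (x, r) = on_obj H (x, r)" if "r \<le> m" for x r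
    using that by (simp add: concat_homotopy_def)
  have upper_obj: "on_obj ?HK (x, r) = on_obj K (x, r - m)" if "x \<in> Obj C" "m \<le> r" for x r
    using that glue_obj by (auto simp: concat_homotopy_def)
  have lower_arr: "on_arr ?HK (f, r, s) = on_arr H (f, r, s)" if "r \<le> m" "s \<le> m" for f r s
    using that by (simp add: concat_homotopy_def)
  have upper_arr: "on_arr ?HK (f, r, s) = on_arr K (f, r - m, s - m)"
    if "f \<in> Arr C" "m \<le> r" "m \<le> s" for f r s
    using that glue_arr by (auto simp: concat_homotopy_def)
  have obj_lower: "(x, r) \<in> Obj (?I m)" if "(x, r) \<in> Obj (?I (m + n))" "r \<le> m" for x r
    using that by (simp add: prod_cat_def interval_cat_def)
  have obj_upper: "x \<in> Obj C" "(x, r - m) \<in> Obj (?I n)"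
    if "(x, r) \<in> Obj (?I (m + n))" "m \<le> r" for x r
    using that by (auto simp: prod_cat_def interval_cat_def)
  have arr_lower: "(f, r, s) \<in> Arr (?I m)" if "(f, r, s) \<in> Arr (?I (m + n))" "r \<le> m" "s \<le> m" for f r s
    using that by (simp add: prod_cat_def interval_cat_def)
  (* Evenness of m makes subtraction of m preserve the direction of arrows. *)
  have arr_upper: "f \<in> Arr C" "(f, r - m, s - m) \<in> Arr (?I n)"
    if "(f, r, s) \<in> Arr (?I (m + n))" "m \<le> r" "m \<le> s" for f r s
    using that assms(2) by (auto simp: prod_cat_def interval_cat_def)
  have halves: "r \<le> m \<and> s \<le> m \<or> m \<le> r \<and> m \<le> s" if "(f, r, s) \<in> Arr (?I (m + n))" for f r s
    using that by (auto simp: prod_cat_def interval_cat_def)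
  have pair_halves: "r \<le> m \<and> s \<le> m \<and> t \<le> m \<or> m \<le> r \<and> m \<le> s \<and> m \<le> t"
    if "(f, r, s) \<in> Arr (?I (m + n))" "(g, s, t) \<in> Arr (?I (m + n))" for f g r s t
    using that by (auto simp: prod_cat_def interval_cat_def)
  have dom: "Dom (?I k) (f, r, s) = (Dom C f, r)" and cod: "Cod (?I k) (f, r, s) = (Cod C f, s)"
    and ident: "Ident (?I k) (x, r) = (Ident C x, r, r)"
    and comp: "Comp (?I k) (g, s', t) (f, r, s) = (Comp C g f, r, t)" for k f g r s s' t x
    by (simp_all add: prod_cat_def interval_cat_def)
  have arr_C: "f \<in> Arr C" if "(f, r, s) \<in> Arr (?I k)" for f r s k
    using that by (simp add: prod_cat_def)
  have is_fun: "is_functor (?I (m + n)) D ?HK"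
  proof unfold_locales
    fix a assume a: "a \<in> Obj (?I (m + n))"
    obtain x r where [simp]: "a = (x, r)" by (cases a)
    have *: "on_obj ?HK (x, r) \<in> Obj D \<and>
      on_arr ?HK (Ident (?I (m + n)) (x, r)) = Ident D (on_obj ?HK (x, r))"
    proof (cases "r \<le> m")
      case True
      with a show ?thesis
        using H.on_obj_in[of "(x, r)"] H.on_arr_Ident[of "(x, r)"]
        by (simp add: ident lower_obj lower_arr obj_lower)
    next
      case False
      then have r: "m \<le> r" by simp
      with a obj_upper[of x r] show ?thesis
        using K.on_obj_in[of "(x, r - m)"] K.on_arr_Ident[of "(x, r - m)"]
        by (simp add: ident upper_obj upper_arr C.Ident_in)
    qed
    then show "on_obj ?HK a \<in> Obj D"
      and "on_arr ?HK (Ident (?I (m + n)) a) = Ident D (on_obj ?HK a)" by simp_all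
  next
    fix u assume u: "u \<in> Arr (?I (m + n))"
    obtain f r s where u_eq: "u = (f, r, s)" by (cases u)
    have frs: "(f, r, s) \<in> Arr (?I (m + n))" using u by (simp add: u_eq)
    have *: "on_arr ?HK u \<in> Arr D \<and> Dom D (on_arr ?HK u) = on_obj ?HK (Dom (?I (m + n)) u)
      \<and> Cod D (on_arr ?HK u) = on_obj ?HK (Cod (?I (m + n)) u)"
    proof (cases "r \<le> m \<and> s \<le> m")
      case True
      then show ?thesis
        using arr_lower[OF frs] H.on_arr_in[of u] H.on_arr_Dom[of u] H.on_arr_Cod[of u]
        by (simp add: u_eq dom cod lower_obj lower_arr)
    next
      case False
      then have "m \<le> r" "m \<le> s" using halves[OF frs] by auto
      then show ?thesis
        using arr_upper[OF frs] K.on_arr_in[of "(f, r - m, s - m)"]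
          K.on_arr_Dom[of "(f, r - m, s - m)"] K.on_arr_Cod[of "(f, r - m, s - m)"]
        by (simp add: u_eq dom cod upper_obj upper_arr C.Dom_in C.Cod_in)
    qed
    then show "on_arr ?HK u \<in> Arr D" "Dom D (on_arr ?HK u) = on_obj ?HK (Dom (?I (m + n)) u)"
      "Cod D (on_arr ?HK u) = on_obj ?HK (Cod (?I (m + n)) u)" by blast+
  next
    fix u v assume u: "u \<in> Arr (?I (m + n))" and v: "v \<in> Arr (?I (m + n))"
      and uv: "Cod (?I (m + n)) u = Dom (?I (m + n)) v"
    obtain f r s where u_eq: "u = (f, r, s)" by (cases u)
    obtain g s' t where v_eq': "v = (g, s', t)" by (cases v)
    from uv have fg: "Cod C f = Dom C g" and v_eq: "v = (g, s, t)"
      by (simp_all add: u_eq v_eq' dom cod)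
    from u v have fr: "(f, r, s) \<in> Arr (?I (m + n))" and gs: "(g, s, t) \<in> Arr (?I (m + n))"
      by (simp_all add: u_eq v_eq)
    have gf: "Comp C g f \<in> Arr C"
      using arr_C[OF fr] arr_C[OF gs] fg by (rule C.Comp_in)
    from pair_halves[OF fr gs]
    show "on_arr ?HK (Comp (?I (m + n)) v u) = Comp D (on_arr ?HK v) (on_arr ?HK u)"
      unfolding u_eq v_eq
    proof (elim disjE conjE)
      assume "r \<le> m" "s \<le> m" "t \<le> m"
      then show "on_arr ?HK (Comp (?I (m + n)) (g, s, t) (f, r, s)) =
        Comp D (on_arr ?HK (g, s, t)) (on_arr ?HK (f, r, s))"
        using arr_lower[OF fr] arr_lower[OF gs] H.on_arr_Comp[of "(f, r, s)" "(g, s, t)"]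
        by (simp add: dom cod comp lower_arr fg)
    next
      assume "m \<le> r" "m \<le> s" "m \<le> t"
      then show "on_arr ?HK (Comp (?I (m + n)) (g, s, t) (f, r, s)) =
        Comp D (on_arr ?HK (g, s, t)) (on_arr ?HK (f, r, s))"
        using arr_upper[OF fr] arr_upper[OF gs]
          K.on_arr_Comp[of "(f, r - m, s - m)" "(g, s - m, t - m)"]
        by (simp add: dom cod comp upper_arr fg gf)
    qed
  qed
  moreover have "functor_eq C (slice_at (m + n) 0 ?HK) F"
    using H by (simp add: homotopy_of_length_def functor_eq_def slice_at_def lower_obj lower_arr
        interval_cat_def)
  moreover have "functor_eq C (slice_at (m + n) (m + n) ?HK) L"
    using K by (simp add: homotopy_of_length_def functor_eq_def slice_at_def upper_obj upper_arr
        interval_cat_def)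
  ultimately show ?thesis
    by (simp add: homotopy_of_length_def)
qed

lemma homotopic_trans:
  assumes "category C" and "homotopic C D F G" and "homotopic C D G L"
  shows "homotopic C D F L"
proof -
  obtain m H where "even m" "homotopy_of_length m C D H F G"
    using assms(1,2) by (rule even_homotopy)
  moreover obtain n K where "homotopy_of_length n C D K G L"
    using assms(3) by (auto simp: homotopic_iff)
  ultimately show ?thesis
    unfolding homotopic_iff by (blast intro: homotopy_of_length_concat[OF assms(1)])
qed

section \<open>Homotopy and composition of functors\<close>

lemma homotopic_comp_left:
  assumes "homotopic C D F G" and "is_functor D E q"
  shows "homotopic C E (comp_functor q F) (comp_functor q G)"
proof -
  obtain m H where H: "homotopy_of_length m C D H F G"
    using assms(1) by (auto simp: homotopic_iff)
  have "is_functor (prod_cat C (interval_cat m)) E (comp_functor q H)"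
    using H assms(2) by (intro is_functor_comp[of _ D]) (simp_all add: homotopy_of_length_def)
  then have "homotopy_of_length m C E (comp_functor q H) (comp_functor q F) (comp_functor q G)"
    using H by (simp add: homotopy_of_length_def functor_eq_def slice_at_def comp_functor_def)
  then show ?thesis by (auto simp: homotopic_iff)
qed

lemma homotopic_comp_right:
  assumes "homotopic C D F G" and "is_functor E C p"
  shows "homotopic E D (comp_functor F p) (comp_functor G p)"
proof -
  interpret p: is_functor E C p by fact
  obtain m H where H: "homotopy_of_length m C D H F G"
    using assms(1) by (auto simp: homotopic_iff)
  let ?K = "comp_functor H (prod_functor p id_functor)"
  have "is_functor (prod_cat E (interval_cat m)) D ?K"
    using H assms(2) is_functor_inclusion[OF subcategory_refl[OF category_interval_cat]]
    by (intro is_functor_comp[OF is_functor_prod]) (auto simp: homotopy_of_length_def)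
  then have "homotopy_of_length m E D ?K (comp_functor F p) (comp_functor G p)"
    using H by (simp add: homotopy_of_length_def functor_eq_def slice_at_def comp_functor_def
        prod_functor_def id_functor_def p.on_obj_in p.on_arr_in)
  then show ?thesis by (auto simp: homotopic_iff)
qed

lemma comp_functor_assoc:
  "comp_functor (comp_functor H G) F = comp_functor H (comp_functor G F)"
  by (simp add: comp_functor_def)

lemma comp_functor_id [simp]: "comp_functor F id_functor = F" "comp_functor id_functor F = F"
  by (simp_all add: comp_functor_def id_functor_def)

lemma homotopic_restrict:
  assumes "homotopic C D F G" and "subcategory U C"
  shows "homotopic U D F G"
  using homotopic_comp_right[OF assms(1) is_functor_inclusion[OF assms(2)]] by simp

section \<open>Pulling back geometric covers\<close>

definition preimage_cat ::
    "('o, 'a) cat \<Rightarrow> ('o, 'a, 'p, 'b) fctr \<Rightarrow> ('p, 'b) cat \<Rightarrow> ('o, 'a) cat" where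
  "preimage_cat E p U =
     E\<lparr>Obj := {x \<in> Obj E. on_obj p x \<in> Obj U}, Arr := {f \<in> Arr E. on_arr p f \<in> Arr U}\<rparr>"

lemma preimage_cat:
  assumes "is_functor E C p" and "subcategory U C"
  shows subcategory_preimage: "subcategory (preimage_cat E p U) E"
    and is_functor_preimage: "is_functor (preimage_cat E p U) U p"
proof -
  interpret E: category E using assms(1) by (rule category_source)
  interpret p: is_functor E C p by fact
  interpret U: category U using assms(2) by (rule category_subcategory)
  interpret U: subcategory U C by fact
  have Dom_U: "on_obj p (Dom E f) = Dom U (on_arr p f)"
    and Cod_U: "on_obj p (Cod E f) = Cod U (on_arr p f)"
    if "f \<in> Arr E" "on_arr p f \<in> Arr U" for f
    using that by (simp_all add: U.Dom_sub U.Cod_sub p.on_arr_Dom p.on_arr_Cod)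
  have Ident_U: "on_arr p (Ident E x) = Ident U (on_obj p x)"
    if "x \<in> Obj E" "on_obj p x \<in> Obj U" for x
    using that by (simp add: U.Ident_sub p.on_arr_Ident)
  have composable_U: "Cod U (on_arr p f) = Dom U (on_arr p g)"
    if "f \<in> Arr E" "g \<in> Arr E" "Cod E f = Dom E g" "on_arr p f \<in> Arr U" "on_arr p g \<in> Arr U" for f g
    using that Dom_U[of g] Cod_U[of f] by simp
  have Comp_U: "on_arr p (Comp E g f) = Comp U (on_arr p g) (on_arr p f)"
    if "f \<in> Arr E" "g \<in> Arr E" "Cod E f = Dom E g" "on_arr p f \<in> Arr U" "on_arr p g \<in> Arr U" for f g
    using that composable_U[of f g] by (simp add: U.Comp_sub p.on_arr_Comp)
  interpret P: category "preimage_cat E p U"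
    by unfold_locales
      (simp_all add: preimage_cat_def E.Dom_in E.Cod_in E.Ident_in E.Dom_Ident E.Cod_Ident
        E.Comp_in E.Dom_Comp E.Cod_Comp E.Comp_Ident_right E.Comp_Ident_left
        E.Comp_assoc Dom_U Cod_U Ident_U Comp_U composable_U
        U.Dom_in U.Cod_in U.Ident_in U.Comp_in)
  show "subcategory (preimage_cat E p U) E"
    by unfold_locales (auto simp: preimage_cat_def)
  show "is_functor (preimage_cat E p U) U p"
    by unfold_locales (auto simp: preimage_cat_def Dom_U Cod_U Ident_U Comp_U)
qed

lemma geometric_cover_preimage:
  assumes "is_functor E C p" and "geometric_cover C L U"
  shows "geometric_cover E L (\<lambda>l. preimage_cat E p (U l))"
  unfolding geometric_cover_def
proof (intro conjI ballI allI impI)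
  fix l assume "l \<in> L"
  then show "subcategory (preimage_cat E p (U l)) E"
    using assms by (intro subcategory_preimage[of E C]) (simp_all add: geometric_cover_def)
next
  interpret p: is_functor E C p by fact
  fix fs assume fs: "composable_arrows E fs"
  have nth_in: "fs ! i \<in> Arr E" if "i < length fs" for i
    using fs nth_mem[OF that] by (auto simp: composable_arrows_def)
  have "composable_arrows C (map (on_arr p) fs)"
    using fs nth_in by (auto simp: composable_arrows_def p.on_arr_in p.on_arr_Dom p.on_arr_Cod)
  then obtain l where "l \<in> L" "set (map (on_arr p) fs) \<subseteq> Arr (U l)"
    using assms(2) unfolding geometric_cover_def by blast
  then show "\<exists>l\<in>L. set fs \<subseteq> Arr (preimage_cat E p (U l))"
    using fs by (intro bexI[of _ l]) (auto simp: composable_arrows_def preimage_cat_def)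
qed

text \<open>
  On the preimage of \<open>U\<close> under \<open>p\<close>, a homotopy from \<open>F\<close> to \<open>G\<close> over \<open>U\<close> yields
  \<open>K \<simeq> q F p \<simeq> q G p \<simeq> L\<close>; the outer homotopies are restrictions of ones given on all of \<open>E\<close>.
\<close>

lemma homotopic_cover_of_size_transfer:
  assumes p: "is_functor E C p" and q: "is_functor D B q"
    and K: "homotopic E B K (comp_functor q (comp_functor F p))"
    and L: "homotopic E B L (comp_functor q (comp_functor G p))"
    and "homotopic_cover_of_size C D F G n"
  shows "homotopic_cover_of_size E B K L n"
proof -
  obtain U where U: "geometric_cover C {..n} U" and FG: "\<And>j. j \<le> n \<Longrightarrow> homotopic (U j) D F G"
    using assms(5) by (auto simp: homotopic_cover_of_size_def)
  have "homotopic (preimage_cat E p (U j)) B K L" if j: "j \<le> n" for j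
  proof -
    let ?V = "preimage_cat E p (U j)"
    have "subcategory (U j) C"
      using U j by (simp add: geometric_cover_def)
    then have V: "subcategory ?V E" and pV: "is_functor ?V (U j) p"
      using preimage_cat[OF p] by blast+
    have V_cat: "category ?V"
      using V by (rule category_subcategory)
    have "homotopic ?V B K (comp_functor q (comp_functor F p))"
      using K V by (rule homotopic_restrict)
    moreover have "homotopic ?V B (comp_functor q (comp_functor F p))
        (comp_functor q (comp_functor G p))"
      using homotopic_comp_right[OF FG[OF j] pV] q by (rule homotopic_comp_left)
    moreover have "homotopic ?V B (comp_functor q (comp_functor G p)) L"
      using V_cat homotopic_restrict[OF L V] by (rule homotopic_sym)
    ultimately show ?thesis
      using homotopic_trans[OF V_cat] by blast
  qed
  then show ?thesis
    using geometric_cover_preimage[OF p U] unfolding homotopic_cover_of_size_def by blast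
qed

section \<open>Invariance of the homotopic distance\<close>

text \<open>
  The square identifies \<open>\<beta> F \<alpha>'\<close> with \<open>F' \<alpha> \<alpha>'\<close>, and \<open>\<alpha> \<alpha>' \<simeq> 1\<close>.
\<close>

lemma homotopic_square_source:
  assumes "is_functor C' D' F'" and \<alpha>: "is_functor C C' \<alpha>" and \<alpha>': "is_functor C' C \<alpha>'"
    and inv: "homotopic C' C' (comp_functor \<alpha> \<alpha>') id_functor"
    and sq: "functor_eq C (comp_functor \<beta> F) (comp_functor F' \<alpha>)"
  shows "homotopic C' D' F' (comp_functor \<beta> (comp_functor F \<alpha>'))"
proof -
  interpret \<alpha>': is_functor C' C \<alpha>' by fact
  have "homotopic C' D' (comp_functor F' (comp_functor \<alpha> \<alpha>')) F'"
    using homotopic_comp_left[OF inv assms(1)] by simp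
  then have "homotopic C' D' F' (comp_functor F' (comp_functor \<alpha> \<alpha>'))"
    by (rule homotopic_sym[OF category_source[OF \<alpha>']])
  moreover have "homotopic C' D' (comp_functor F' (comp_functor \<alpha> \<alpha>'))
      (comp_functor \<beta> (comp_functor F \<alpha>'))"
  proof (rule homotopic_functor_eq)
    show "is_functor C' D' (comp_functor F' (comp_functor \<alpha> \<alpha>'))"
      using is_functor_comp[OF \<alpha>' \<alpha>] assms(1) by (rule is_functor_comp)
    show "functor_eq C' (comp_functor F' (comp_functor \<alpha> \<alpha>')) (comp_functor \<beta> (comp_functor F \<alpha>'))"
      using sq by (simp add: functor_eq_def comp_functor_def \<alpha>'.on_obj_in \<alpha>'.on_arr_in)
  qed
  ultimately show ?thesis
    by (rule homotopic_trans[OF category_source[OF \<alpha>']])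
qed

text \<open>
  The square identifies \<open>\<beta>' F' \<alpha>\<close> with \<open>\<beta>' \<beta> F\<close>, and \<open>\<beta>' \<beta> \<simeq> 1\<close>.
\<close>

lemma homotopic_square_target:
  assumes F: "is_functor C D F" and \<beta>: "is_functor D D' \<beta>" and \<beta>': "is_functor D' D \<beta>'"
    and inv: "homotopic D D (comp_functor \<beta>' \<beta>) id_functor"
    and sq: "functor_eq C (comp_functor \<beta> F) (comp_functor F' \<alpha>)"
  shows "homotopic C D F (comp_functor \<beta>' (comp_functor F' \<alpha>))"
proof -
  have "homotopic C D (comp_functor \<beta>' (comp_functor \<beta> F)) F"
    using homotopic_comp_right[OF inv F] by (simp add: comp_functor_assoc)
  then have "homotopic C D F (comp_functor \<beta>' (comp_functor \<beta> F))"
    by (rule homotopic_sym[OF category_source[OF F]])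
  moreover have "homotopic C D (comp_functor \<beta>' (comp_functor \<beta> F))
      (comp_functor \<beta>' (comp_functor F' \<alpha>))"
  proof (rule homotopic_functor_eq)
    show "is_functor C D (comp_functor \<beta>' (comp_functor \<beta> F))"
      using is_functor_comp[OF F \<beta>] \<beta>' by (rule is_functor_comp)
    show "functor_eq C (comp_functor \<beta>' (comp_functor \<beta> F)) (comp_functor \<beta>' (comp_functor F' \<alpha>))"
      using sq by (simp add: functor_eq_def comp_functor_def)
  qed
  ultimately show ?thesis
    by (rule homotopic_trans[OF category_source[OF F]])
qed

theorem proposition4p12:
  fixes C :: "('o1, 'a1) cat" and C' :: "('o2, 'a2) cat"
    and D :: "('o3, 'a3) cat" and D' :: "('o4, 'a4) cat"
    and \<alpha> :: "('o1, 'a1, 'o2, 'a2) fctr" and \<beta> :: "('o3, 'a3, 'o4, 'a4) fctr"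
    and F G :: "('o1, 'a1, 'o3, 'a3) fctr" and F' G' :: "('o2, 'a2, 'o4, 'a4) fctr"
  assumes "category C" and "connected_category C"
    and "category C'" and "connected_category C'"
    and "category D" and "connected_category D"
    and "category D'" and "connected_category D'"
    and "homotopy_equivalence C C' \<alpha>"
    and "homotopy_equivalence D D' \<beta>"
    and "is_functor C D F" and "is_functor C D G"
    and "is_functor C' D' F'" and "is_functor C' D' G'"
    and "functor_eq C (comp_functor \<beta> F) (comp_functor F' \<alpha>)"
    and "functor_eq C (comp_functor \<beta> G) (comp_functor G' \<alpha>)"
  shows "cD C D F G = cD C' D' F' G'"
proof -
  obtain \<alpha>' where \<alpha>: "is_functor C C' \<alpha>" and \<alpha>': "is_functor C' C \<alpha>'"
    and \<alpha>_inv: "homotopic C' C' (comp_functor \<alpha> \<alpha>') id_functor"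
    using assms(9) by (auto simp: homotopy_equivalence_def)
  obtain \<beta>' where \<beta>: "is_functor D D' \<beta>" and \<beta>': "is_functor D' D \<beta>'"
    and \<beta>_inv: "homotopic D D (comp_functor \<beta>' \<beta>) id_functor"
    using assms(10) by (auto simp: homotopy_equivalence_def)
  have "homotopic_cover_of_size C D F G n \<longleftrightarrow> homotopic_cover_of_size C' D' F' G' n" for n
  proof
    assume "homotopic_cover_of_size C D F G n"
    then show "homotopic_cover_of_size C' D' F' G' n"
      by (rule homotopic_cover_of_size_transfer[OF \<alpha>' \<beta>
            homotopic_square_source[OF assms(13) \<alpha> \<alpha>' \<alpha>_inv assms(15)]
            homotopic_square_source[OF assms(14) \<alpha> \<alpha>' \<alpha>_inv assms(16)]])
  next
    assume "homotopic_cover_of_size C' D' F' G' n"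
    then show "homotopic_cover_of_size C D F G n"
      by (rule homotopic_cover_of_size_transfer[OF \<alpha> \<beta>'
            homotopic_square_target[OF assms(11) \<beta> \<beta>' \<beta>_inv assms(15)]
            homotopic_square_target[OF assms(12) \<beta> \<beta>' \<beta>_inv assms(16)]])
  qed
  then have "homotopic_cover_of_size C D F G = homotopic_cover_of_size C' D' F' G'"
    by blast
  then show ?thesis
    by (simp add: cD_def)
qed

end
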